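(* For $|q|<1$ and all complex parameters $z,\omega$, $$\sum_{n_1\ge 0}\sum_{n_2\ge 0}\frac{z^{n_1}\omega^{n_2}q^{n_1^2+2n_1n_2+2n_2^2+2n_2}(-zq;q^2)_{n_2}}{(q^2;q^2)_{n_1}(q^4;q^4)_{n_2}}=(-zq;q^4)_\infty(-zq^3;q^4)_\infty(-\omega q^4;q^4)_\infty .$$
   Context: Notation: $(a;q)_n=\prod_{j=0}^{n-1}(1-aq^j)$ and $(a;q)_\infty=\prod_{j=0}^\infty(1-aq^j)$ for $|q|<1$. *)

theory Defs
  imports "HOL-Analysis.Analysis"
begin

definition qpoch :: "complex \<Rightarrow> complex \<Rightarrow> nat \<Rightarrow> complex" where
  "qpoch a q n = (\<Prod>j<n. 1 - a * q ^ j)"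

text \<open>Meant for \<open>norm q < 1\<close>, where the product converges; vanishing factors are harmless, as
  \<^const>\<open>prodinf\<close> then gives \<open>0\<close>.\<close>
definition qpoch_inf :: "complex \<Rightarrow> complex \<Rightarrow> complex" where
  "qpoch_inf a q = (\<Prod>j. 1 - a * q ^ j)"

end

theory Submission
  imports Defs
begin

text \<open>Both summations are instances of Euler's identity
  \<open>\<Sum>n. x\<^sup>n q\<^bsup>n(n-1)/2\<^esup> / (q;q)\<^sub>n = (-x;q)\<^sub>\<infinity>\<close>, whose left-hand side \<open>F\<close> is an entire function with
  \<open>F x = (1 + x) F (x q)\<close> and \<open>F 0 = 1\<close>. In base \<open>q\<^sup>2\<close> the sum over \<open>n1\<close> is
  \<open>(-z q\<^bsup>1 + 2 n2\<^esup>; q\<^sup>2)\<^sub>\<infinity>\<close>, which absorbs \<open>(-z q; q\<^sup>2)\<close> of length \<open>n2\<close> to give \<open>(-z q; q\<^sup>2)\<^sub>\<infinity>\<close>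
  independently of \<open>n2\<close>; the sum over \<open>n2\<close> is then Euler's identity in base \<open>q\<^sup>4\<close>.\<close>

lemma qpoch_0 [simp]: "qpoch a q 0 = 1"
  by (simp add: qpoch_def)

lemma qpoch_Suc: "qpoch a q (Suc n) = qpoch a q n * (1 - a * q ^ n)"
  by (simp add: qpoch_def)

lemma qpoch_self_nonzero:
  assumes "norm q < 1"
  shows "qpoch q q n \<noteq> 0"
proof -
  have "1 - q * q ^ j \<noteq> 0" for j
  proof -
    have "norm (q ^ Suc j) < 1"
      unfolding norm_power using assms by (intro power_less_one_iff[THEN iffD2]) auto
    then show ?thesis
      by auto
  qed
  then show ?thesis
    by (simp add: qpoch_def)
qed

text \<open>The factors differ from 1 by terms of a geometric series, so the product converges
  absolutely. Zero factors do no harm: \<open>has_prod\<close> allows them, and the partial products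
  still tend to its value.\<close>

lemma qpoch_LIMSEQ:
  assumes "norm q < 1"
  shows "qpoch a q \<longlonglongrightarrow> qpoch_inf a q"
proof -
  have "summable (\<lambda>j. norm ((1 - a * q ^ j) - 1))"
    using assms by (auto simp: norm_mult norm_power intro!: summable_mult summable_geometric)
  then have "convergent_prod (\<lambda>j. 1 - a * q ^ j)"
    by (intro abs_convergent_prod_imp_convergent_prod summable_imp_abs_convergent_prod)
  then have "(\<lambda>j. 1 - a * q ^ j) has_prod qpoch_inf a q"
    unfolding qpoch_inf_def by (rule convergent_prod_has_prod)
  then show ?thesis
    unfolding qpoch_def[abs_def] by (rule has_prod_imp_tendsto')
qed

lemma qpoch_add: "qpoch a q (n + m) = qpoch a q n * qpoch (a * q ^ n) q m"
  by (induction m) (simp_all add: qpoch_Suc power_add mult_ac)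

text \<open>Stated as a product rather than a quotient, since \<open>qpoch a q n\<close> may
  vanish.\<close>

lemma qpoch_inf_shift:
  assumes "norm q < 1"
  shows "qpoch a q n * qpoch_inf (a * q ^ n) q = qpoch_inf a q"
proof (rule LIMSEQ_unique)
  show "(\<lambda>m. qpoch a q (m + n)) \<longlonglongrightarrow> qpoch a q n * qpoch_inf (a * q ^ n) q"
    by (subst add.commute) (simp only: qpoch_add tendsto_mult_left qpoch_LIMSEQ[OF assms])
  show "(\<lambda>m. qpoch a q (m + n)) \<longlonglongrightarrow> qpoch_inf a q"
    by (intro LIMSEQ_ignore_initial_segment qpoch_LIMSEQ assms)
qed

lemma qpoch_double: "qpoch a (q\<^sup>2) n * qpoch (a * q) (q\<^sup>2) n = qpoch a q (2 * n)"
proof (induction n)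
  case (Suc n)
  have "qpoch a q (2 * Suc n) = qpoch a q (2 * n) * ((1 - a * q ^ (2 * n)) * (1 - a * q * q ^ (2 * n)))"
    by (simp add: qpoch_Suc mult.assoc)
  then show ?case
    unfolding Suc[symmetric] qpoch_Suc power_mult by (simp only: mult_ac)
qed simp

text \<open>Even and odd powers of \<open>q\<close> are separated. Applied with \<open>q^2\<close>
  for \<open>q\<close>, this produces the two base \<open>q^4\<close> products in
  \<open>z\<close>.\<close>

lemma qpoch_inf_dissect:
  assumes "norm q < 1"
  shows "qpoch_inf a (q\<^sup>2) * qpoch_inf (a * q) (q\<^sup>2) = qpoch_inf a q"
proof (rule LIMSEQ_unique)
  have "norm (q\<^sup>2) < 1"
    using assms by (simp add: norm_power power_less_one_iff)
  then show "(\<lambda>n. qpoch a q (2 * n)) \<longlonglongrightarrow> qpoch_inf a (q\<^sup>2) * qpoch_inf (a * q) (q\<^sup>2)"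
    unfolding qpoch_double[symmetric] by (intro tendsto_mult qpoch_LIMSEQ)
  show "(\<lambda>n. qpoch a q (2 * n)) \<longlonglongrightarrow> qpoch_inf a q"
    using LIMSEQ_subseq_LIMSEQ[OF qpoch_LIMSEQ[OF assms], of "\<lambda>n. 2 * n"]
    by (simp add: o_def strict_mono_def)
qed

definition euler_term :: "complex \<Rightarrow> complex \<Rightarrow> nat \<Rightarrow> complex" where
  "euler_term q x n = x ^ n * q ^ (n choose 2) / qpoch q q n"

lemma euler_term_0 [simp]: "euler_term q x 0 = 1"
  by (simp add: euler_term_def numeral_2_eq_2)

lemma euler_term_Suc:
  "euler_term q x (Suc n) = euler_term q x n * (x * q ^ n / (1 - q ^ Suc n))"
  by (simp add: euler_term_def qpoch_Suc numeral_2_eq_2 power_add)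

text \<open>With c = q this drives the functional equation, with x = 1 it exhibits a power series,
  and with c = (q^2)^n2 it absorbs the cross factor q^(2 n1 n2) of the double sum.\<close>

lemma euler_term_scale: "euler_term q (x * c) n = euler_term q x n * c ^ n"
  by (simp add: euler_term_def power_mult_distrib)

lemma summable_norm_euler_term:
  assumes "norm q < 1"
  shows "summable (\<lambda>n. norm (euler_term q x n))"
proof -
  \<comment> \<open>The ratio of consecutive terms tends to 0; 1/2 below is an arbitrary bound less
    than 1.\<close>
  have "(\<lambda>n. norm (x * q ^ n / (1 - q ^ Suc n))) \<longlonglongrightarrow> norm (x * 0 / (1 - 0))"
    by (intro tendsto_intros LIMSEQ_power_zero LIMSEQ_Suc assms) auto
  then have "eventually (\<lambda>n. norm (x * q ^ n / (1 - q ^ Suc n)) < 1 / 2) sequentially"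
    by (intro order_tendstoD(2)) auto
  then obtain N where N: "\<And>n. n \<ge> N \<Longrightarrow> norm (x * q ^ n / (1 - q ^ Suc n)) < 1 / 2"
    unfolding eventually_sequentially by blast
  show ?thesis
  proof (rule summable_ratio_test)
    fix n assume "n \<ge> N"
    then show "norm (norm (euler_term q x (Suc n))) \<le> 1 / 2 * norm (norm (euler_term q x n))"
      using mult_left_mono[OF less_imp_le[OF N] norm_ge_zero[of "euler_term q x n"]]
      unfolding euler_term_Suc norm_mult[of "euler_term q x n"] by simp
  qed simp
qed

lemma euler_sum_functional_equation:
  assumes "norm q < 1"
  shows "suminf (euler_term q x) = (1 + x) * suminf (euler_term q (x * q))"
proof -
  have sm: "summable (euler_term q y)" for y
    using summable_norm_cancel[OF summable_norm_euler_term[OF assms]] .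
  \<comment> \<open>Scaling by \<open>q\<close> multiplies term n + 1 by q^(n+1), so the difference
    carries the factor 1 - q^(n+1), which cancels the last factor of the denominator.\<close>
  have "euler_term q x (Suc n) - euler_term q (x * q) (Suc n) = x * euler_term q (x * q) n" for n
  proof -
    have "1 - q ^ Suc n \<noteq> 0"
      using qpoch_self_nonzero[OF assms, of "Suc n"] by (simp add: qpoch_Suc)
    then have "euler_term q x (Suc n) * (1 - q ^ Suc n) = x * (euler_term q x n * q ^ n)"
      unfolding euler_term_Suc by simp
    then show ?thesis
      by (simp only: euler_term_scale right_diff_distrib mult_1_right)
  qed
  then have "(\<Sum>n. euler_term q x (Suc n) - euler_term q (x * q) (Suc n)) =
      x * suminf (euler_term q (x * q))"
    by (simp add: suminf_mult sm)
  \<comment> \<open>Both series start with the term 1, so dropping the heads leaves the difference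
    unchanged.\<close>
  moreover have "(\<Sum>n. euler_term q x (Suc n) - euler_term q (x * q) (Suc n)) =
      suminf (euler_term q x) - suminf (euler_term q (x * q))"
    by (subst suminf_diff[symmetric]) (simp_all add: summable_Suc_iff sm suminf_split_head)
  ultimately show ?thesis
    by (simp add: algebra_simps)
qed

text \<open>Iterating the functional equation n times gives F(x) = (-x;q)_n F(x q^n). As n grows,
  the last factor tends to F(0) = 1 because a power series is continuous at 0.\<close>

theorem euler_has_sum:
  assumes "norm q < 1"
  shows "(euler_term q x has_sum qpoch_inf (- x) q) UNIV"
proof -
  define F where "F y = suminf (euler_term q y)" for y
  have term_powser: "euler_term q y n = euler_term q 1 n * y ^ n" for y n
    using euler_term_scale[of q 1 y n] by simp
  have sm: "summable (euler_term q y)" for y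
    using summable_norm_cancel[OF summable_norm_euler_term[OF assms]] .
  have F_powser: "F = (\<lambda>y. \<Sum>n. euler_term q 1 n * y ^ n)"
    by (simp add: F_def fun_eq_iff flip: term_powser)
  have "isCont F 0"
    unfolding F_powser
    by (rule isCont_powser_converges_everywhere) (use sm in \<open>simp flip: term_powser\<close>)
  moreover have "(\<lambda>n. x * q ^ n) \<longlonglongrightarrow> 0"
    using tendsto_mult_right_zero[OF LIMSEQ_power_zero[OF assms]] .
  moreover have "F 0 = 1"
    unfolding F_powser powser_zero by simp
  ultimately have F_lim: "(\<lambda>n. F (x * q ^ n)) \<longlonglongrightarrow> 1"
    using isCont_tendsto_compose[of 0 F] by fastforce
  have "qpoch (- x) q n * F (x * q ^ n) = F x" for n
  proof (induction n)
    case (Suc n)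
    have "F (x * q ^ n) = (1 + x * q ^ n) * F (x * q ^ Suc n)"
      unfolding F_def using euler_sum_functional_equation[OF assms, of "x * q ^ n"]
      by (simp add: mult_ac)
    with Suc show ?case
      by (simp add: qpoch_Suc mult_ac)
  qed simp
  then have "(\<lambda>n. F x) \<longlonglongrightarrow> qpoch_inf (- x) q * 1"
    using tendsto_mult[OF qpoch_LIMSEQ[OF assms, of "- x"] F_lim] by simp
  then have "F x = qpoch_inf (- x) q"
    by (simp add: LIMSEQ_const_iff)
  then show ?thesis
    using norm_summable_imp_has_sum[OF summable_norm_euler_term[OF assms]] sm
    by (metis F_def summable_sums)
qed

lemma summable_on_Times_mult:
  fixes f :: "'a \<Rightarrow> real" and g :: "'b \<Rightarrow> real"
  assumes "f summable_on A" "g summable_on B"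
  shows "(\<lambda>(x, y). f x * g y) summable_on A \<times> B"
proof -
  have "(\<lambda>x. norm (f x)) summable_on A" "(\<lambda>y. norm (g y)) summable_on B"
    using assms by (simp_all only: summable_on_iff_abs_summable_on_real[THEN iffD1])
  then have "(\<lambda>p. norm (f (fst p) * g (snd p))) summable_on A \<times> B"
    by (subst Infinite_Sum.abs_summable_on_Sigma_iff)
      (auto simp: abs_mult infsum_cmult_right' summable_on_cmult_right summable_on_cmult_left)
  then show ?thesis
    unfolding case_prod_unfold by (rule abs_summable_summable)
qed

lemma two_mult_choose_two: "2 * (n choose 2) + n = n\<^sup>2"
  by (induction n) (simp_all add: numeral_2_eq_2)

theorem mainTheorem4:
  fixes q z \<omega> :: complex
  assumes "norm q < 1"
  shows "((\<lambda>(n1 :: nat, n2 :: nat).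
            z ^ n1 * \<omega> ^ n2 * q ^ (n1\<^sup>2 + 2 * n1 * n2 + 2 * n2\<^sup>2 + 2 * n2) * qpoch (- z * q) (q\<^sup>2) n2
              / (qpoch (q\<^sup>2) (q\<^sup>2) n1 * qpoch (q ^ 4) (q ^ 4) n2))
          has_sum
            (qpoch_inf (- z * q) (q ^ 4) * qpoch_inf (- z * q ^ 3) (q ^ 4)
              * qpoch_inf (- \<omega> * q ^ 4) (q ^ 4)))
          (UNIV \<times> UNIV)"
proof -
  define P where "P = qpoch (- z * q) (q\<^sup>2)"
  define E where "E = euler_term (q\<^sup>2) (z * q)"
  define G where "G = euler_term (q ^ 4) (\<omega> * q ^ 4)"
  have q2: "norm (q\<^sup>2) < 1" and q4: "norm (q ^ 4) < 1"
    using assms by (simp_all add: norm_power power_less_one_iff)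
  \<comment> \<open>The terms are grouped as the exponent of \<open>E n1\<close>, the cross term,
    and, in parentheses, the exponent of \<open>G n2\<close>.\<close>
  have exponent: "n1\<^sup>2 + 2 * n1 * n2 + 2 * n2\<^sup>2 + 2 * n2 =
      n1 + 2 * (n1 choose 2) + 2 * n2 * n1 + (4 * n2 + 4 * (n2 choose 2))" for n1 n2 :: nat
    using two_mult_choose_two[of n1] two_mult_choose_two[of n2] by (simp add: algebra_simps)
  have term_eq: "z ^ n1 * \<omega> ^ n2 * q ^ (n1\<^sup>2 + 2 * n1 * n2 + 2 * n2\<^sup>2 + 2 * n2) * qpoch (- z * q) (q\<^sup>2) n2
              / (qpoch (q\<^sup>2) (q\<^sup>2) n1 * qpoch (q ^ 4) (q ^ 4) n2)
      = P n2 * (E n1 * (q\<^sup>2) ^ (n2 * n1)) * G n2" for n1 n2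
    unfolding exponent
    by (simp add: P_def E_def G_def euler_term_def power_mult_distrib power_add mult_ac
        flip: power_mult)
  have inner: "((\<lambda>n1. P n2 * (E n1 * (q\<^sup>2) ^ (n2 * n1)) * G n2) has_sum
      qpoch_inf (- z * q) (q\<^sup>2) * G n2) UNIV" for n2
  proof -
    have "((\<lambda>n1. E n1 * (q\<^sup>2) ^ (n2 * n1)) has_sum qpoch_inf (- z * q * (q\<^sup>2) ^ n2) (q\<^sup>2)) UNIV"
      using euler_has_sum[OF q2, of "z * q * (q\<^sup>2) ^ n2"]
      unfolding E_def euler_term_scale[of "q\<^sup>2" "z * q"] by (simp add: power_mult)
    then show ?thesis
      unfolding qpoch_inf_shift[OF q2, of "- z * q" n2, symmetric] P_def
      by (intro has_sum_cmult_right has_sum_cmult_left)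
  qed
  have outer: "((\<lambda>n2. qpoch_inf (- z * q) (q\<^sup>2) * G n2) has_sum
      qpoch_inf (- z * q) (q\<^sup>2) * qpoch_inf (- \<omega> * q ^ 4) (q ^ 4)) UNIV"
    using has_sum_cmult_right[OF euler_has_sum[OF q4, of "\<omega> * q ^ 4"]] by (simp add: G_def)
  \<comment> \<open>A bound on \<open>P\<close> uniform in n2, together with |q^(2 n1 n2)| \<le> 1,
    dominates the double series by a product of two convergent single series.\<close>
  have "Bseq P"
    unfolding P_def using qpoch_LIMSEQ[OF q2] by (intro convergent_imp_Bseq convergentI)
  then obtain C where C: "C > 0" "\<And>n. norm (P n) \<le> C"
    by (auto elim: BseqE)
  have "(\<lambda>n. C * norm (G n)) summable_on UNIV" "(\<lambda>n. norm (E n)) summable_on UNIV"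
    unfolding E_def G_def
    by (intro summable_on_cmult_right norm_summable_imp_summable_on;
        simp add: summable_norm_euler_term q2 q4)+
  \<comment> \<open>The pairs are ordered (n2, n1) so that the iterated sum runs over n1 first;
    \<open>has_sum_swap\<close> restores the order at the end.\<close>
  then have "(\<lambda>(n2, n1). (C * norm (G n2)) * norm (E n1)) summable_on UNIV \<times> UNIV"
    by (rule summable_on_Times_mult)
  then have "(\<lambda>p. norm ((\<lambda>(n2, n1). P n2 * (E n1 * (q\<^sup>2) ^ (n2 * n1)) * G n2) p))
      summable_on UNIV \<times> UNIV"
  proof (rule Infinite_Sum.abs_summable_on_comparison_test', clarify)
    fix n2 n1
    have "norm (q ^ k) \<le> 1" for k
      using assms by (simp add: norm_power power_le_one)
    then have "norm (E n1) * norm ((q\<^sup>2) ^ (n2 * n1)) \<le> norm (E n1)"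
      by (simp add: mult_left_le flip: power_mult)
    then have "norm (P n2) * (norm (E n1) * norm ((q\<^sup>2) ^ (n2 * n1))) \<le> C * norm (E n1)"
      using C by (intro mult_mono) auto
    then have "norm (P n2) * (norm (E n1) * norm ((q\<^sup>2) ^ (n2 * n1))) * norm (G n2)
        \<le> C * norm (E n1) * norm (G n2)"
      by (intro mult_right_mono) auto
    then show "norm (P n2 * (E n1 * (q\<^sup>2) ^ (n2 * n1)) * G n2) \<le> C * norm (G n2) * norm (E n1)"
      by (simp add: norm_mult mult_ac)
  qed
  \<comment> \<open>Joint absolute summability is what turns the iterated sums \<open>inner\<close>
    and \<open>outer\<close> into an unordered sum over pairs.\<close>
  then have "((\<lambda>(n2, n1). P n2 * (E n1 * (q\<^sup>2) ^ (n2 * n1)) * G n2) has_sum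
      qpoch_inf (- z * q) (q\<^sup>2) * qpoch_inf (- \<omega> * q ^ 4) (q ^ 4)) (UNIV \<times> UNIV)"
    using inner
    by (intro has_sum_SigmaI[OF _ outer abs_summable_summable]) (simp_all only: prod.case)
  moreover have "qpoch_inf (- z * q) (q\<^sup>2) =
      qpoch_inf (- z * q) (q ^ 4) * qpoch_inf (- z * q ^ 3) (q ^ 4)"
  proof -
    have "(q\<^sup>2)\<^sup>2 = q ^ 4" "- z * q * q\<^sup>2 = - z * q ^ 3"
      by (simp_all add: power2_eq_square power3_eq_cube power4_eq_xxxx)
    then show ?thesis
      using qpoch_inf_dissect[OF q2, of "- z * q"] by (simp only:)
  qed
  ultimately show ?thesis
    unfolding term_eq by (subst has_sum_swap) (simp only: prod.case)
qed

end
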